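(* Let $q$ be a complex number with $|q|<1$, with a fixed choice of $q^{1/2}$, and let $k\ge 1$ be an integer. Then $$\sum_{n_1,\dots,n_k\geq 0} \frac{q^{N_1^2+N_2^2+\cdots+N_k^2+N_1+\cdots+N_k}}{(q;q)_{n_1}\cdots(q;q)_{n_{k-1}}(-q^{1/2};q)_{n_k+1}(q^2;q^2)_{n_k}} =\frac{(q^{\frac{1}{2}},q^{1+2k},q^{\frac{3}{2}+2k};q^{\frac{3}{2}+2k})_\infty}{(q;q)_\infty},$$ where $N_j=n_j+n_{j+1}+\cdots+n_k$ for $1\le j\le k$.
   Context: For $|q|<1$: $(a;q)_\infty=\prod_{m=0}^\infty(1-aq^m)$, $(a;q)_n=(a;q)_\infty/(aq^n;q)_\infty=\prod_{m=0}^{n-1}(1-aq^m)$ for integers $n\ge0$, and $(a_1,\dots,a_r;q)_\infty=(a_1;q)_\infty\cdots(a_r;q)_\infty$; the same notation is used with the base $q$ replaced by another power of $q$. Half-integer powers of $q$ are understood as integer powers of the fixed square root $q^{1/2}$. *)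

theory Defs
  imports "HOL-Analysis.Analysis"
begin

definition qpoch_inf :: "complex \<Rightarrow> complex \<Rightarrow> complex" where
  "qpoch_inf a q = (\<Prod>m. 1 - a * q ^ m)"

definition qpoch :: "complex \<Rightarrow> complex \<Rightarrow> nat \<Rightarrow> complex" where
  "qpoch a q n = (\<Prod>m<n. 1 - a * q ^ m)"

definition qpoch_inf_list :: "complex list \<Rightarrow> complex \<Rightarrow> complex" where
  "qpoch_inf_list as q = (\<Prod>a\<leftarrow>as. qpoch_inf a q)"

definition tail_sum :: "nat \<Rightarrow> (nat \<Rightarrow> nat) \<Rightarrow> nat \<Rightarrow> nat" where
  "tail_sum k n j = (\<Sum>i=j..k. n i)"

end

theory Submission
  imports Defs
begin

text \<open>
  The proof runs along the Bailey chain relative to $a = q$. Write \<open>(q)\<^sub>n\<close> for \<open>qpoch q q n\<close>.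
  If \<open>\<beta> n = (\<Sum>r\<le>n. \<alpha> r / ((q)\<^sub>n\<^sub>-\<^sub>r (q)\<^sub>n\<^sub>+\<^sub>r\<^sub>+\<^sub>1))\<close>, then replacing \<open>\<alpha> r\<close> by \<open>q^(r\<^sup>2+r) \<alpha> r\<close> replaces
  \<open>\<beta> n\<close> by \<open>\<Sum>j\<le>n. q^(j\<^sup>2+j) \<beta> j / (q)\<^sub>n\<^sub>-\<^sub>j\<close> (lemma \<open>bailey_lemma\<close>, a consequence of the
  $q$-Vandermonde sum). Iterating this step on the \<open>\<beta>\<close> side produces exactly the multiple sum over
  \<open>N\<^sub>1 \<ge> \<dots> \<ge> N\<^sub>k\<close> (lemma \<open>has_sum_multi_term\<close>), while on the \<open>\<alpha>\<close> side it only multiplies by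
  \<open>q^(k(r\<^sup>2+r))\<close>. Letting \<open>n \<rightarrow> \<infinity>\<close> in the iterated pair, by Tannery's theorem, expresses the multiple sum
  as \<open>(\<Sum>r. q^(k(r\<^sup>2+r)) \<alpha> r) / (q;q)\<^sub>\<infinity>\<close>.

  The innermost factor \<open>1 / ((-s;q)\<^sub>n\<^sub>+\<^sub>1 (q\<^sup>2;q\<^sup>2)\<^sub>n)\<close>, with \<open>s\<^sup>2 = q\<close>, is the \<open>\<beta>\<close> of a Bailey pair whose \<open>\<alpha>\<close>
  comes from folding the two-sided sequence \<open>(-1)^r s^(r(3r+1)/2)\<close> at \<open>r \<leftrightarrow> -1-r\<close>
  (lemma \<open>seed_bailey_pair\<close>). Multiplied by \<open>q^(k(r\<^sup>2+r))\<close>, the same two-sided sequence becomes the general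
  term of the theta series with base \<open>Q = s^(4k+3)\<close>, and Jacobi's triple product turns its sum into
  \<open>(s, q^(2k+1), Q; Q)\<^sub>\<infinity>\<close> (lemma \<open>suminf_seed_alpha\<close>).

  Both of these inputs are evaluations of one type of finite sum,
  \<open>\<Sum>r. a r / ((q)\<^sub>n\<^sub>-\<^sub>r (q)\<^sub>n\<^sub>+\<^sub>r\<^sub>+\<^sub>1)\<close> over the integers, together with its companion with \<open>n+r\<close> in place of
  \<open>n+r+1\<close>. The two forms of the $q$-Pascal rule pass from one kind of sum to the other
  (lemmas \<open>odd_sum_step\<close> and \<open>even_sum_step\<close>). For the triple product, each step just multiplies the
  sequence \<open>a\<close> by a constant; for the sequence \<open>(-1)^r s^(r(3r+1)/2)\<close>, a step multiplies the sum by a constant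
  only after one uses the reflection symmetries of the summation range.
\<close>

section \<open>Finite and infinite Pochhammer symbols\<close>

lemma one_minus_power_nonzero:
  fixes q :: complex
  assumes "norm q < 1" "0 < m"
  shows "1 - q ^ m \<noteq> 0"
proof
  assume "1 - q ^ m = 0"
  then have "norm q ^ m = 1" by (metis eq_iff_diff_eq_0 norm_one norm_power)
  then show False using assms power_less_one_iff[of "norm q" m] by simp
qed

lemma qpoch_0 [simp]: "qpoch a q 0 = 1"
  by (simp add: qpoch_def)

lemma qpoch_Suc: "qpoch a q (Suc n) = qpoch a q n * (1 - a * q ^ n)"
  by (simp add: qpoch_def)

lemma qpoch_self_Suc: "qpoch q q (Suc n) = qpoch q q n * (1 - q ^ Suc n)"
  by (simp add: qpoch_Suc)

lemma qpoch_factor_nonzero: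
  fixes a q :: complex
  assumes "norm a < 1" "norm q < 1"
  shows "1 - a * q ^ m \<noteq> 0"
proof
  assume "1 - a * q ^ m = 0"
  then have "norm a * norm q ^ m = 1"
    by (metis eq_iff_diff_eq_0 norm_mult norm_one norm_power)
  moreover have "norm a * norm q ^ m \<le> norm a"
    using assms by (intro mult_left_le) (auto intro: power_le_one)
  ultimately show False using assms by simp
qed

lemma qpoch_nonzero:
  assumes "norm a < 1" "norm q < 1"
  shows "qpoch a q n \<noteq> 0"
  using qpoch_factor_nonzero[OF assms] by (simp add: qpoch_def)

lemma convergent_prod_qpoch:
  fixes a q :: complex
  assumes "norm q < 1"
  shows "convergent_prod (\<lambda>m. 1 - a * q ^ m)"
proof (rule abs_convergent_prod_imp_convergent_prod, rule summable_imp_abs_convergent_prod)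
  show "summable (\<lambda>m. norm (1 - a * q ^ m - 1))"
    using assms by (simp add: norm_mult norm_power summable_mult summable_geometric)
qed

lemma qpoch_tendsto:
  assumes "norm q < 1"
  shows "qpoch a q \<longlonglongrightarrow> qpoch_inf a q"
proof -
  have "(\<lambda>n. qpoch a q (Suc n)) \<longlonglongrightarrow> qpoch_inf a q"
    using convergent_prod_LIMSEQ[OF convergent_prod_qpoch[OF assms, of a]]
    unfolding qpoch_def qpoch_inf_def lessThan_Suc_atMost .
  then show ?thesis by (rule LIMSEQ_imp_Suc)
qed

lemma qpoch_inf_nonzero:
  assumes "norm a < 1" "norm q < 1"
  shows "qpoch_inf a q \<noteq> 0"
  unfolding qpoch_inf_def
  by (intro prodinf_nonzero convergent_prod_qpoch qpoch_factor_nonzero assms)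

lemma bounded_of_tendsto:
  fixes f :: "nat \<Rightarrow> complex"
  assumes "f \<longlonglongrightarrow> l"
  shows "\<exists>C. \<forall>n. norm (f n) \<le> C"
  using convergentI[OF assms, THEN convergent_imp_Bseq] unfolding Bseq_def by blast

lemma inverse_qpoch_bounded:
  assumes "norm q < 1"
  shows "\<exists>D. \<forall>n. norm (1 / qpoch q q n) \<le> D"
  using qpoch_inf_nonzero[OF assms assms]
  by (intro bounded_of_tendsto[OF tendsto_divide[OF tendsto_const[of 1] qpoch_tendsto[OF assms, of q]]])

text \<open>
  Tannery's theorem, applied to the series \<open>\<Sum>r. x r * c n r\<close> cut off at \<open>r = n\<close>: both limits of the Bailey
  transform below are of this shape, with \<open>c\<close> a product of reciprocals of finite $q$-factorials.
\<close>
lemma tannery_triangular: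
  fixes x :: "nat \<Rightarrow> complex" and c :: "nat \<Rightarrow> nat \<Rightarrow> complex"
  assumes x: "summable (\<lambda>r. norm (x r))"
    and bound: "\<And>n r. r \<le> n \<Longrightarrow> norm (c n r) \<le> C"
    and lim: "\<And>r. (\<lambda>n. c n r) \<longlonglongrightarrow> l"
  shows "(\<lambda>n. \<Sum>r\<le>n. x r * c n r) \<longlonglongrightarrow> (\<Sum>r. x r) * l"
proof -
  define a where "a = (\<lambda>r n. if r \<le> n then x r * c n r else 0)"
  have C: "0 \<le> C" using bound[of 0 0] norm_ge_zero order_trans by blast
  have "(\<lambda>n. suminf (\<lambda>r. a r n)) \<longlonglongrightarrow> suminf (\<lambda>r. x r * l)"
  proof (intro tannerys_theorem[THEN conjunct2, THEN conjunct2])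
    fix r
    have "(\<lambda>n. x r * c n r) \<longlonglongrightarrow> x r * l" by (intro tendsto_intros lim)
    moreover have "\<forall>\<^sub>F n in sequentially. x r * c n r = a r n"
      using eventually_ge_at_top[of r] by eventually_elim (simp add: a_def)
    ultimately show "(\<lambda>n. a r n) \<longlonglongrightarrow> x r * l"
      using Lim_transform_eventually by blast
  next
    show "\<forall>\<^sub>F (r, n) in sequentially \<times>\<^sub>F sequentially. norm (a r n) \<le> norm (x r) * C"
      using bound C by (intro always_eventually) (auto simp: a_def norm_mult intro: mult_left_mono)
    show "summable (\<lambda>r. norm (x r) * C)" by (intro summable_mult2 x)
  qed auto
  moreover have "suminf (\<lambda>r. a r n) = (\<Sum>r\<le>n. x r * c n r)" for n
  proof -
    have "suminf (\<lambda>r. a r n) = (\<Sum>r\<le>n. a r n)"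
      by (intro suminf_finite) (auto simp: a_def)
    then show ?thesis by (simp add: a_def)
  qed
  moreover have "suminf (\<lambda>r. x r * l) = (\<Sum>r. x r) * l"
    using suminf_mult2[OF summable_norm_cancel[OF x]] by simp
  ultimately show ?thesis by simp
qed

section \<open>Bailey pairs and the Bailey chain\<close>

text \<open>
  Bailey pairs relative to $a = q$. The usual normalisation has \<open>(q\<^sup>2;q)\<^sub>n\<^sub>+\<^sub>r = (q)\<^sub>n\<^sub>+\<^sub>r\<^sub>+\<^sub>1 / (1 - q)\<close> in the
  denominator; the constant \<open>1 - q\<close> is absorbed into \<open>\<alpha>\<close> here.
\<close>
definition bailey_pair :: "complex \<Rightarrow> (nat \<Rightarrow> complex) \<Rightarrow> (nat \<Rightarrow> complex) \<Rightarrow> bool" where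
  "bailey_pair q \<alpha> \<beta> \<longleftrightarrow>
     (\<forall>n. \<beta> n = (\<Sum>r\<le>n. \<alpha> r / (qpoch q q (n - r) * qpoch q q (n + r + 1))))"

text \<open>
  The action on \<open>\<beta>\<close> of Bailey's lemma when both of its free parameters tend to infinity.
\<close>
definition bailey_step :: "complex \<Rightarrow> (nat \<Rightarrow> complex) \<Rightarrow> nat \<Rightarrow> complex" where
  "bailey_step q \<beta> n = (\<Sum>j\<le>n. q ^ (j\<^sup>2 + j) * \<beta> j / qpoch q q (n - j))"

text \<open>
  The factor \<open>1 - q^(N+1)\<close> times the sum for \<open>N+1\<close> splits, by the $q$-Pascal rule in the form
  \<open>1 - q^(N+1) = (1 - q^(N+1-i)) + q^(N+1-i) (1 - q^i)\<close>, into the sum for \<open>(N, c)\<close> and \<open>q^(N+c+1)\<close> times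
  the sum for \<open>(N, c+1)\<close>. The induction therefore has to run for all \<open>c\<close> at once.
\<close>
lemma q_vandermonde:
  assumes q: "norm q < 1"
  shows "(\<Sum>i\<le>N. q ^ (i * (i + c)) / (qpoch q q (N - i) * qpoch q q i * qpoch q q (i + c)))
         = 1 / (qpoch q q N * qpoch q q (N + c))"
proof (induction N arbitrary: c)
  case (Suc N)
  note nz = qpoch_nonzero[OF q q] 
  have nz1: "1 - q ^ Suc m \<noteq> 0" for m using one_minus_power_nonzero[OF q] by blast
  define f where "f = (\<lambda>N c i. q ^ (i * (i + c)) / (qpoch q q (N - i) * qpoch q q i * qpoch q q (i + c)))"
  have IH: "(\<Sum>i\<le>N. f N c i) = 1 / (qpoch q q N * qpoch q q (N + c))" for c
    using Suc.IH unfolding f_def .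
  have "(1 - q ^ Suc N) * (\<Sum>i\<le>Suc N. f (Suc N) c i)
      = (\<Sum>i\<le>Suc N. (1 - q ^ (Suc N - i)) * f (Suc N) c i)
      + (\<Sum>i\<le>Suc N. q ^ (Suc N - i) * (1 - q ^ i) * f (Suc N) c i)"
    unfolding sum_distrib_left sum.distrib[symmetric]
    by (intro sum.cong refl) (simp add: algebra_simps flip: power_add)
  also have "(\<Sum>i\<le>Suc N. (1 - q ^ (Suc N - i)) * f (Suc N) c i) = (\<Sum>i\<le>N. f N c i)"
    unfolding sum.atMost_Suc
  proof -
    have "(1 - q ^ (Suc N - i)) * f (Suc N) c i = f N c i" if "i \<le> N" for i
      using nz nz1[of "N - i"] that
      by (simp add: f_def Suc_diff_le qpoch_self_Suc del: power_Suc)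
    then show "(\<Sum>i\<le>N. (1 - q ^ (Suc N - i)) * f (Suc N) c i) +
               (1 - q ^ (Suc N - Suc N)) * f (Suc N) c (Suc N) = (\<Sum>i\<le>N. f N c i)"
      by simp
  qed
  also have "(\<Sum>i\<le>Suc N. q ^ (Suc N - i) * (1 - q ^ i) * f (Suc N) c i)
      = (\<Sum>i\<le>N. q ^ (N + c + 1) * f N (Suc c) i)"
    unfolding sum.atMost_Suc_shift
  proof -
    have "q ^ (Suc N - Suc i) * (1 - q ^ Suc i) * f (Suc N) c (Suc i) = q ^ (N + c + 1) * f N (Suc c) i"
      if "i \<le> N" for i
    proof -
      have e: "N - i + Suc i * (Suc i + c) = (N + c + 1) + i * (i + Suc c)"
        using that by (simp add: algebra_simps)
      have "q ^ (Suc N - Suc i) * (1 - q ^ Suc i) * f (Suc N) c (Suc i)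
          = q ^ (N - i + Suc i * (Suc i + c)) * (1 - q ^ Suc i) /
            (qpoch q q (N - i) * qpoch q q (Suc i) * qpoch q q (i + Suc c))"
        by (simp add: f_def power_add del: power_Suc mult_Suc mult_Suc_right)
      also have "\<dots> = q ^ (N - i + Suc i * (Suc i + c)) /
            (qpoch q q (N - i) * qpoch q q i * qpoch q q (i + Suc c))"
        using nz1[of i] by (simp add: qpoch_self_Suc[of q i] del: power_Suc)
      also have "\<dots> = q ^ (N + c + 1) * f N (Suc c) i"
        unfolding e f_def by (simp add: power_add)
      finally show ?thesis .
    qed
    then show "q ^ (Suc N - 0) * (1 - q ^ 0) * f (Suc N) c 0 +
        (\<Sum>i\<le>N. q ^ (Suc N - Suc i) * (1 - q ^ Suc i) * f (Suc N) c (Suc i)) =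
        (\<Sum>i\<le>N. q ^ (N + c + 1) * f N (Suc c) i)" by simp
  qed
  also have "(\<Sum>i\<le>N. f N c i) + (\<Sum>i\<le>N. q ^ (N + c + 1) * f N (Suc c) i)
      = 1 / (qpoch q q N * qpoch q q (N + c)) + q ^ (N + c + 1) / (qpoch q q N * qpoch q q (Suc (N + c)))"
    unfolding sum_distrib_left[symmetric] IH by simp
  also have "\<dots> = (1 - q ^ Suc N) * (1 / (qpoch q q (Suc N) * qpoch q q (Suc N + c)))"
  proof -
    have "1 / (qpoch q q N * qpoch q q (N + c)) 
        = (1 - q ^ Suc (N + c)) / (qpoch q q N * qpoch q q (Suc (N + c)))"
      using nz1[of "N + c"] by (simp add: qpoch_self_Suc del: power_Suc)
    then have "1 / (qpoch q q N * qpoch q q (N + c)) + q ^ (N + c + 1) / (qpoch q q N * qpoch q q (Suc (N + c)))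
       = 1 / (qpoch q q N * qpoch q q (Suc (N + c)))"
      by (simp add: diff_divide_distrib)
    then show ?thesis using nz1[of N] by (simp add: qpoch_self_Suc[of q N] del: power_Suc)
  qed
  finally have "(\<Sum>i\<le>Suc N. f (Suc N) c i) = 1 / (qpoch q q (Suc N) * qpoch q q (Suc N + c))"
    unfolding mult_left_cancel[OF nz1] .
  then show ?case unfolding f_def .
qed simp

text \<open>
  After exchanging the order of summation, the coefficient of \<open>\<alpha> r\<close> is a $q$-Vandermonde sum in \<open>i = j - r\<close>
  with \<open>N = n - r\<close> and \<open>c = 2r + 1\<close>, because
  \<open>(r+i)\<^sup>2 + (r+i) = (r\<^sup>2 + r) + i (i + 2r + 1)\<close>.
\<close>
lemma bailey_lemma:
  assumes q: "norm q < 1" and "bailey_pair q \<alpha> \<beta>"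
  shows "bailey_pair q (\<lambda>r. q ^ (r\<^sup>2 + r) * \<alpha> r) (bailey_step q \<beta>)"
  unfolding bailey_pair_def
proof
  fix n
  have \<beta>: "\<beta> n = (\<Sum>r\<le>n. \<alpha> r / (qpoch q q (n - r) * qpoch q q (n + r + 1)))" for n
    using assms(2) unfolding bailey_pair_def by blast
  define t where "t = (\<lambda>j r. q ^ (j\<^sup>2 + j) * \<alpha> r /
      (qpoch q q (n - j) * qpoch q q (j - r) * qpoch q q (j + r + 1)))"
  have "bailey_step q \<beta> n = (\<Sum>j\<le>n. \<Sum>r\<le>j. t j r)"
    unfolding bailey_step_def \<beta> t_def
    by (intro sum.cong refl) (simp add: sum_distrib_left sum_divide_distrib mult_ac)
  also have "\<dots> = (\<Sum>r\<le>n. \<Sum>j=r..n. t j r)"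
    using sum.triangle_reindex_eq[of "\<lambda>i j. t (i+j) j" n] 
    by (simp add: sum.Sigma) (rule sum.reindex_bij_witness[of _ "\<lambda>(r, j). (j, r)" "\<lambda>(j, r). (r, j)"], auto)
  also have "\<dots> = (\<Sum>r\<le>n. q ^ (r\<^sup>2 + r) * \<alpha> r / (qpoch q q (n - r) * qpoch q q (n + r + 1)))"
  proof (intro sum.cong refl)
    fix r assume "r \<in> {..n}"
    then have r: "r \<le> n" by simp
    have "(\<Sum>j=r..n. t j r) = (\<Sum>i\<le>n - r. t (r + i) r)"
      using r by (intro sum.reindex_bij_witness[of _ "\<lambda>i. r + i" "\<lambda>j. j - r"]) auto
    also have "\<dots> = (\<Sum>i\<le>n - r. q ^ (r\<^sup>2 + r) * \<alpha> r * (q ^ (i * (i + (2 * r + 1))) /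
        (qpoch q q (n - r - i) * qpoch q q i * qpoch q q (i + (2 * r + 1)))))"
    proof (intro sum.cong refl)
      fix i
      have e: "(r + i)\<^sup>2 + (r + i) = (r\<^sup>2 + r) + i * (i + (2 * r + 1))"
        by (simp add: power2_eq_square algebra_simps)
      have e2: "r + i + r + 1 = i + (2 * r + 1)" "n - (r + i) = n - r - i" by simp_all
      show "t (r + i) r = q ^ (r\<^sup>2 + r) * \<alpha> r * (q ^ (i * (i + (2 * r + 1))) /
        (qpoch q q (n - r - i) * qpoch q q i * qpoch q q (i + (2 * r + 1))))"
        unfolding t_def e e2 power_add[of q "r\<^sup>2 + r"] by simp
    qed
    also have "\<dots> = q ^ (r\<^sup>2 + r) * \<alpha> r / (qpoch q q (n - r) * qpoch q q (n + r + 1))"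
      unfolding sum_distrib_left[symmetric] q_vandermonde[OF q] using r by (simp add: mult_2)
    finally show "(\<Sum>j=r..n. t j r) =
        q ^ (r\<^sup>2 + r) * \<alpha> r / (qpoch q q (n - r) * qpoch q q (n + r + 1))" .
  qed
  finally show "bailey_step q \<beta> n =
      (\<Sum>r\<le>n. q ^ (r\<^sup>2 + r) * \<alpha> r / (qpoch q q (n - r) * qpoch q q (n + r + 1)))" .
qed

lemma bailey_lemma_iterated:
  assumes "norm q < 1" and "bailey_pair q \<alpha> \<beta>"
  shows "bailey_pair q (\<lambda>r. q ^ (m * (r\<^sup>2 + r)) * \<alpha> r) ((bailey_step q ^^ m) \<beta>)"
proof (induction m)
  case 0
  then show ?case using assms by simp
next
  case (Suc m)
  from bailey_lemma[OF assms(1) Suc] show ?case by (simp add: power_add mult_ac)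
qed

text \<open>
  Both $q$-factorials in the denominator tend to \<open>(q;q)\<^sub>\<infinity>\<close> for fixed \<open>r\<close>.
\<close>
lemma bailey_pair_limit:
  assumes q: "norm q < 1" and "bailey_pair q \<alpha> \<beta>" and "summable (\<lambda>r. norm (\<alpha> r))"
  shows "\<beta> \<longlonglongrightarrow> (\<Sum>r. \<alpha> r) / (qpoch_inf q q)\<^sup>2"
proof -
  obtain D where D: "\<And>n. norm (1 / qpoch q q n) \<le> D"
    using inverse_qpoch_bounded[OF q] by blast
  then have D0: "0 \<le> D" using norm_ge_zero order_trans by blast
  have "(\<lambda>n. \<Sum>r\<le>n. \<alpha> r * (1 / qpoch q q (n - r) * (1 / qpoch q q (n + (r + 1)))))
     \<longlonglongrightarrow> (\<Sum>r. \<alpha> r) * (1 / qpoch_inf q q * (1 / qpoch_inf q q))"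
  proof (rule tannery_triangular)
    show "norm (1 / qpoch q q (n - r) * (1 / qpoch q q (n + (r + 1)))) \<le> D * D" for n r
      unfolding norm_mult by (intro mult_mono D D0 norm_ge_zero)
    show "(\<lambda>n. 1 / qpoch q q (n - r) * (1 / qpoch q q (n + (r + 1))))
        \<longlonglongrightarrow> 1 / qpoch_inf q q * (1 / qpoch_inf q q)" for r
    proof (intro tendsto_intros qpoch_inf_nonzero q)
      show "(\<lambda>n. qpoch q q (n - r)) \<longlonglongrightarrow> qpoch_inf q q"
        by (rule LIMSEQ_offset[of _ r]) (simp add: qpoch_tendsto[OF q])
      show "(\<lambda>n. qpoch q q (n + (r + 1))) \<longlonglongrightarrow> qpoch_inf q q"
        by (rule LIMSEQ_ignore_initial_segment[OF qpoch_tendsto[OF q]])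
    qed
  qed fact
  moreover have "\<beta> = (\<lambda>n. \<Sum>r\<le>n. \<alpha> r * (1 / qpoch q q (n - r) * (1 / qpoch q q (n + (r + 1)))))"
    using assms(2) unfolding bailey_pair_def by (intro ext) simp
  ultimately show ?thesis by (simp add: power2_eq_square)
qed

lemma summable_power_square_mult_bounded:
  fixes q :: complex
  assumes "norm q < 1" "\<And>n. norm (\<beta> n) \<le> C"
  shows "summable (\<lambda>n. norm (q ^ (n\<^sup>2 + n) * \<beta> n))"
proof (rule summable_comparison_test')
  have C: "0 \<le> C" using assms(2)[of 0] norm_ge_zero order_trans by blast
  show "summable (\<lambda>n. norm q ^ n * C)"
    using assms by (intro summable_mult2 summable_geometric) simp
  show "norm (norm (q ^ (n\<^sup>2 + n) * \<beta> n)) \<le> norm q ^ n * C" if "n \<ge> 0" for n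
    using assms C by (auto simp: norm_mult norm_power intro!: mult_mono power_decreasing)
qed

text \<open>
  Comparing this limit with that of \<open>bailey_pair_limit\<close> for the same sequence evaluates
  \<open>\<Sum>n. q^(n\<^sup>2+n) \<beta> n\<close>.
\<close>
lemma bailey_step_limit:
  assumes q: "norm q < 1" and "\<And>n. norm (\<beta> n) \<le> C"
  shows "bailey_step q \<beta> \<longlonglongrightarrow> (\<Sum>n. q ^ (n\<^sup>2 + n) * \<beta> n) / qpoch_inf q q"
proof -
  obtain D where D: "\<And>n. norm (1 / qpoch q q n) \<le> D"
    using inverse_qpoch_bounded[OF q] by blast
  have "(\<lambda>n. \<Sum>j\<le>n. (q ^ (j\<^sup>2 + j) * \<beta> j) * (1 / qpoch q q (n - j)))
     \<longlonglongrightarrow> (\<Sum>j. q ^ (j\<^sup>2 + j) * \<beta> j) * (1 / qpoch_inf q q)"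
  proof (rule tannery_triangular)
    show "summable (\<lambda>j. norm (q ^ (j\<^sup>2 + j) * \<beta> j))"
      by (rule summable_power_square_mult_bounded[OF assms])
    show "(\<lambda>n. 1 / qpoch q q (n - r)) \<longlonglongrightarrow> 1 / qpoch_inf q q" for r
    proof (intro tendsto_intros qpoch_inf_nonzero q)
      show "(\<lambda>n. qpoch q q (n - r)) \<longlonglongrightarrow> qpoch_inf q q"
        by (rule LIMSEQ_offset[of _ r]) (simp add: qpoch_tendsto[OF q])
    qed
  qed (rule D)
  then show ?thesis unfolding bailey_step_def[abs_def] by simp
qed

lemma bailey_step_iterated_bounded:
  assumes q: "norm q < 1" and "\<And>n. norm (\<beta> n) \<le> C"
  shows "\<exists>C. \<forall>n. norm ((bailey_step q ^^ m) \<beta> n) \<le> C"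
proof (induction m)
  case 0
  then show ?case using assms by auto
next
  case (Suc m)
  then obtain C' where "\<And>n. norm ((bailey_step q ^^ m) \<beta> n) \<le> C'" by blast
  from bounded_of_tendsto[OF bailey_step_limit[OF q this]] show ?case by simp
qed

section \<open>Two-sided sums and the finite triple product\<close>

text \<open>
  Extending \<open>1 / (q)\<^sub>k\<close> by zero to negative \<open>k\<close> makes the recurrence \<open>recip_qpoch_pred\<close> hold for every integer,
  so that sums over \<open>r\<close> can be shifted without boundary terms.
\<close>
definition recip_qpoch :: "complex \<Rightarrow> int \<Rightarrow> complex" where
  "recip_qpoch q k = (if k < 0 then 0 else 1 / qpoch q q (nat k))"

lemma recip_qpoch_pred:
  assumes q: "norm q < 1"
  shows "recip_qpoch q (k - 1) = (1 - q powi k) * recip_qpoch q k"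
proof (cases "k \<le> 0")
  case True
  then show ?thesis by (cases "k = 0") (auto simp: recip_qpoch_def)
next
  case False
  then obtain m where k: "k = int (Suc m)" by (metis gr0_implies_Suc not_le zero_less_imp_eq_int)
  have "1 - q ^ Suc m \<noteq> 0" using one_minus_power_nonzero[OF q] by blast
  then show ?thesis
    unfolding k power_int_of_nat by (simp add: recip_qpoch_def qpoch_self_Suc nat_add_distrib del: power_Suc)
qed

text \<open>
  The $q$-Pascal rule for \<open>(q)\<^sub>k\<^sub>+\<^sub>l / ((q)\<^sub>k (q)\<^sub>l)\<close>, cleared of the numerator.
\<close>
lemma recip_qpoch_pascal:
  assumes q: "norm q < 1" "q \<noteq> 0"
  shows "(1 - q powi (k + l)) * (recip_qpoch q k * recip_qpoch q l)
       = recip_qpoch q k * recip_qpoch q (l - 1) + q powi l * (recip_qpoch q (k - 1) * recip_qpoch q l)"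
  unfolding recip_qpoch_pred[OF q(1)] using q(2) by (simp add: power_int_add algebra_simps)

text \<open>
  Up to the factor \<open>(q)\<^sub>2\<^sub>n\<close> or \<open>(q)\<^sub>2\<^sub>n\<^sub>+\<^sub>1\<close>, these are the sums of \<open>a\<close> against the
  $q$-binomial coefficients of row \<open>2n\<close> or \<open>2n+1\<close>, indexed from the centre of the row.
\<close>
definition even_sum :: "complex \<Rightarrow> (int \<Rightarrow> complex) \<Rightarrow> nat \<Rightarrow> complex" where
  "even_sum q a n = (\<Sum>r = - int n..int n. a r * (recip_qpoch q (int n - r) * recip_qpoch q (int n + r)))"

definition odd_sum :: "complex \<Rightarrow> (int \<Rightarrow> complex) \<Rightarrow> nat \<Rightarrow> complex" where
  "odd_sum q a n = (\<Sum>r = - int n - 1..int n. a r * (recip_qpoch q (int n - r) * recip_qpoch q (int n + r + 1)))"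

lemma even_sum_add: "even_sum q (\<lambda>r. a r + b r) n = even_sum q a n + even_sum q b n"
  by (simp add: even_sum_def distrib_right sum.distrib)

lemma odd_sum_add: "odd_sum q (\<lambda>r. a r + b r) n = odd_sum q a n + odd_sum q b n"
  by (simp add: odd_sum_def distrib_right sum.distrib)

lemma even_sum_scale: "even_sum q (\<lambda>r. c * a r) n = c * even_sum q a n"
  by (simp add: even_sum_def sum_distrib_left mult.assoc)

lemma odd_sum_scale: "odd_sum q (\<lambda>r. c * a r) n = c * odd_sum q a n"
  by (simp add: odd_sum_def sum_distrib_left mult.assoc)

lemma even_sum_reflect: "even_sum q (\<lambda>r. a (- r)) n = even_sum q a n"
  unfolding even_sum_def by (rule sum.reindex_bij_witness[of _ uminus uminus]) auto

lemma odd_sum_reflect: "odd_sum q (\<lambda>r. a (- 1 - r)) n = odd_sum q a n"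
  unfolding odd_sum_def
  by (rule sum.reindex_bij_witness[of _ "\<lambda>r. - 1 - r" "\<lambda>r. - 1 - r"]) (auto simp: algebra_simps)

text \<open>
  The $q$-Pascal rule splits row \<open>2n+1\<close> into two copies of row \<open>2n\<close>; the second copy is centred at
  \<open>r + 1\<close> and is shifted back.
\<close>
lemma odd_sum_step:
  assumes q: "norm q < 1" "q \<noteq> 0"
  shows "(1 - q ^ (2 * n + 1)) * odd_sum q a n
       = even_sum q (\<lambda>r. a r + q powi (int n + r) * a (r - 1)) n"
proof -
  let ?\<rho> = "recip_qpoch q"
  have pow: "q ^ (2 * n + 1) = q powi ((int n - r) + (int n + r + 1))" for r
    unfolding power_int_of_nat[symmetric] by (rule arg_cong[of _ _ "power_int q"]) simp
  have "(1 - q ^ (2 * n + 1)) * odd_sum q a n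
      = (\<Sum>r = - int n - 1..int n. a r * (?\<rho> (int n - r) * ?\<rho> (int n + r)))
      + (\<Sum>r = - int n - 1..int n. q powi (int n + r + 1) * a r * (?\<rho> (int n - r - 1) * ?\<rho> (int n + r + 1)))"
    unfolding odd_sum_def sum_distrib_left sum.distrib[symmetric]
  proof (intro sum.cong refl)
    fix r
    have "(1 - q ^ (2 * n + 1)) * (?\<rho> (int n - r) * ?\<rho> (int n + r + 1))
        = ?\<rho> (int n - r) * ?\<rho> (int n + r)
        + q powi (int n + r + 1) * (?\<rho> (int n - r - 1) * ?\<rho> (int n + r + 1))"
      unfolding pow[of r] recip_qpoch_pascal[OF q] by simp
    from arg_cong[OF this, of "\<lambda>x. a r * x"]
    show "(1 - q ^ (2 * n + 1)) * (a r * (?\<rho> (int n - r) * ?\<rho> (int n + r + 1))) =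
        a r * (?\<rho> (int n - r) * ?\<rho> (int n + r)) +
        q powi (int n + r + 1) * a r * (?\<rho> (int n - r - 1) * ?\<rho> (int n + r + 1))"
      by (simp only: distrib_left mult_ac)
  qed
  also have "(\<Sum>r = - int n - 1..int n. a r * (?\<rho> (int n - r) * ?\<rho> (int n + r))) = even_sum q a n"
    unfolding even_sum_def by (rule sum.mono_neutral_right) (auto simp: recip_qpoch_def)
  also have "(\<Sum>r = - int n - 1..int n. q powi (int n + r + 1) * a r * (?\<rho> (int n - r - 1) * ?\<rho> (int n + r + 1)))
      = even_sum q (\<lambda>r. q powi (int n + r) * a (r - 1)) n"
    unfolding even_sum_def
    by (rule sum.reindex_bij_witness_not_neutral
          [of "{int n}" "{}" _ "\<lambda>r. r - 1" "\<lambda>r. r + 1"])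
       (auto simp: recip_qpoch_def algebra_simps)
  finally show ?thesis by (simp add: even_sum_add)
qed

text \<open>
  Here the $q$-Pascal rule is used with the roles of its two lower indices exchanged, which moves the shift
  to the other side.
\<close>
lemma even_sum_step:
  assumes q: "norm q < 1" "q \<noteq> 0"
  shows "(1 - q ^ (2 * n + 2)) * even_sum q a (Suc n)
       = odd_sum q (\<lambda>r. a r + q powi (int n - r) * a (r + 1)) n"
proof -
  let ?\<rho> = "recip_qpoch q"
  have pow: "q ^ (2 * n + 2) = q powi ((int n + 1 + r) + (int n + 1 - r))" for r
    unfolding power_int_of_nat[symmetric] by (rule arg_cong[of _ _ "power_int q"]) simp
  have "(1 - q ^ (2 * n + 2)) * even_sum q a (Suc n)
      = (\<Sum>r = - int n - 1..int n + 1. a r * (?\<rho> (int n - r) * ?\<rho> (int n + 1 + r)))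
      + (\<Sum>r = - int n - 1..int n + 1. q powi (int n + 1 - r) * a r * (?\<rho> (int n + r) * ?\<rho> (int n + 1 - r)))"
    unfolding even_sum_def sum_distrib_left sum.distrib[symmetric]
  proof (intro sum.cong)
    fix r
    have "(1 - q ^ (2 * n + 2)) * (?\<rho> (int (Suc n) - r) * ?\<rho> (int (Suc n) + r))
        = ?\<rho> (int n - r) * ?\<rho> (int n + 1 + r)
        + q powi (int n + 1 - r) * (?\<rho> (int n + r) * ?\<rho> (int n + 1 - r))"
      using recip_qpoch_pascal[OF q, of "int n + 1 + r" "int n + 1 - r"]
      unfolding pow[of r] by (simp add: ac_simps)
    from arg_cong[OF this, of "\<lambda>x. a r * x"]
    show "(1 - q ^ (2 * n + 2)) * (a r * (?\<rho> (int (Suc n) - r) * ?\<rho> (int (Suc n) + r))) =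
        a r * (?\<rho> (int n - r) * ?\<rho> (int n + 1 + r)) +
        q powi (int n + 1 - r) * a r * (?\<rho> (int n + r) * ?\<rho> (int n + 1 - r))"
      by (simp only: distrib_left mult_ac)
  qed auto
  also have "(\<Sum>r = - int n - 1..int n + 1. a r * (?\<rho> (int n - r) * ?\<rho> (int n + 1 + r))) = odd_sum q a n"
    unfolding odd_sum_def
    by (rule sum.mono_neutral_cong_right) (auto simp: recip_qpoch_def algebra_simps)
  also have "(\<Sum>r = - int n - 1..int n + 1. q powi (int n + 1 - r) * a r * (?\<rho> (int n + r) * ?\<rho> (int n + 1 - r)))
      = odd_sum q (\<lambda>r. q powi (int n - r) * a (r + 1)) n"
    unfolding odd_sum_def
    by (rule sum.reindex_bij_witness_not_neutral
          [of "{- int n - 1}" "{}" _ "\<lambda>r. r + 1" "\<lambda>r. r - 1"])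
       (auto simp: recip_qpoch_def algebra_simps)
  finally show ?thesis by (simp add: odd_sum_add)
qed

text \<open>
  The weight in \<open>odd_sum\<close> is invariant under \<open>r \<leftrightarrow> -1-r\<close>, so a sum over all integers folds to a Bailey pair
  over the natural numbers.
\<close>
lemma bailey_pair_odd_sum:
  "bailey_pair q (\<lambda>r. a (int r) + a (- 1 - int r)) (odd_sum q a)"
  unfolding bailey_pair_def
proof
  fix n
  let ?w = "\<lambda>r. recip_qpoch q (int n - r) * recip_qpoch q (int n + r + 1)"
  have "{- int n - 1..int n} = {0..int n} \<union> {- int n - 1..-1}" by auto
  then have "odd_sum q a n = (\<Sum>r = 0..int n. a r * ?w r) + (\<Sum>r = - int n - 1..-1. a r * ?w r)"
    unfolding odd_sum_def by (simp add: sum.union_disjoint)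
  also have "(\<Sum>r = 0..int n. a r * ?w r) = (\<Sum>r\<le>n. a (int r) * ?w (int r))"
    by (rule sum.reindex_bij_witness[of _ int nat]) auto
  also have "(\<Sum>r = - int n - 1..-1. a r * ?w r) = (\<Sum>r\<le>n. a (- 1 - int r) * ?w (int r))"
    by (rule sum.reindex_bij_witness[of _ "\<lambda>r. - 1 - int r" "\<lambda>r. nat (- 1 - r)"])
       (auto simp: algebra_simps)
  also have "(\<Sum>r\<le>n. a (int r) * ?w (int r)) + (\<Sum>r\<le>n. a (- 1 - int r) * ?w (int r))
      = (\<Sum>r\<le>n. (a (int r) + a (- 1 - int r)) / (qpoch q q (n - r) * qpoch q q (n + r + 1)))"
    unfolding sum.distrib[symmetric]
  proof (intro sum.cong refl)
    fix r assume "r \<in> {..n}"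
    then have "?w (int r) = 1 / (qpoch q q (n - r) * qpoch q q (n + r + 1))"
      by (simp add: recip_qpoch_def nat_add_distrib nat_diff_distrib)
    then show "a (int r) * ?w (int r) + a (- 1 - int r) * ?w (int r) =
        (a (int r) + a (- 1 - int r)) / (qpoch q q (n - r) * qpoch q q (n + r + 1))"
      by (simp only: distrib_right[symmetric]) simp
  qed
  finally show "odd_sum q a n =
    (\<Sum>r\<le>n. (a (int r) + a (- 1 - int r)) / (qpoch q q (n - r) * qpoch q q (n + r + 1)))" .
qed

text \<open>
  The recurrence says that \<open>a r = (-1)^r q^(r(r+1)/2) z^(-r)\<close>. Under it the shifted terms in the two steps are
  \<open>- z q^n\<close> and \<open>- w q^n\<close> times the unshifted ones, so each step contributes one linear factor of the product.
\<close>
lemma finite_jacobi_triple_product: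
  assumes q: "norm q < 1" "q \<noteq> 0" and zw: "z * w = q"
    and a0: "a 0 = 1" and rec: "\<And>r. a (r - 1) * q powi r = - z * a r"
  shows "even_sum q a n = qpoch z q n * qpoch w q n / qpoch q q (2 * n)"
    and "odd_sum q a n = qpoch z q (Suc n) * qpoch w q n / qpoch q q (2 * n + 1)"
proof -
  have nz: "1 - q ^ Suc m \<noteq> 0" for m using one_minus_power_nonzero[OF q(1)] by blast
  have z: "z \<noteq> 0" using zw q by auto
  have "(1 - q ^ (2 * n + 1)) * odd_sum q a n = (1 - z * q ^ n) * even_sum q a n" for n
  proof -
    have "a r + q powi (int n + r) * a (r - 1) = (1 - z * q ^ n) * a r" for r
      using arg_cong[OF rec[of r], of "\<lambda>x. q ^ n * x"] q by (simp add: power_int_add algebra_simps)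
    then show ?thesis unfolding odd_sum_step[OF q] by (simp add: even_sum_scale)
  qed
  then have odd: "odd_sum q a n = (1 - z * q ^ n) * even_sum q a n / (1 - q ^ Suc (2 * n))" for n
    using nz[of "2 * n"] by (simp add: eq_divide_eq mult.commute)
  have "(1 - q ^ (2 * n + 2)) * even_sum q a (Suc n) = (1 - w * q ^ n) * odd_sum q a n" for n
  proof -
    have "a r + q powi (int n - r) * a (r + 1) = (1 - w * q ^ n) * a r" for r
    proof -
      have "z * (q powi (int n - r) * a (r + 1)) = - (q powi (int n - r) * (a r * q powi (r + 1)))"
        using rec[of "r + 1"] by (simp add: algebra_simps)
      also have "\<dots> = - (q powi ((int n - r) + (r + 1)) * a r)"
        using q by (subst power_int_add) auto
      also have "\<dots> = z * (- w * q ^ n * a r)"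
        using q by (simp add: power_int_add flip: zw)
      finally have "q powi (int n - r) * a (r + 1) = - w * q ^ n * a r"
        using mult_left_cancel[OF z] by blast
      then show ?thesis by (simp add: algebra_simps)
    qed
    then show ?thesis unfolding even_sum_step[OF q] by (simp add: odd_sum_scale)
  qed
  then have even: "even_sum q a (Suc n) = (1 - w * q ^ n) * odd_sum q a n / (1 - q ^ Suc (2 * n + 1))" for n
    using nz[of "2 * n + 1"] by (simp add: eq_divide_eq mult.commute)
  show *: "even_sum q a n = qpoch z q n * qpoch w q n / qpoch q q (2 * n)" for n
  proof (induction n)
    case 0
    then show ?case by (simp add: even_sum_def recip_qpoch_def a0)
  next
    case (Suc n)
    have e: "2 * Suc n = Suc (Suc (2 * n))" by simp
    show ?case unfolding even odd Suc e qpoch_Suc[of z] qpoch_Suc[of w] qpoch_self_Suc by simp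
  qed
  show "odd_sum q a n = qpoch z q (Suc n) * qpoch w q n / qpoch q q (2 * n + 1)"
    unfolding odd * by (simp add: qpoch_Suc)
qed

section \<open>The theta sequence\<close>

text \<open>
  The term \<open>(-1)^r q^(k r(r+1)) q^(r(3r+1)/4)\<close> of the theta series, written in the square root \<open>s\<close> of \<open>q\<close>.
\<close>
definition theta_coeff :: "complex \<Rightarrow> nat \<Rightarrow> int \<Rightarrow> complex" where
  "theta_coeff s k r = (-1) powi r * s powi (2 * int k * (r * (r + 1)) + r * (3 * r + 1) div 2)"

lemma two_mult_pentagonal: "2 * (r * (3 * r + 1) div 2) = r * (3 * r + 1)" for r :: int
  by (rule dvd_mult_div_cancel) auto

lemma theta_coeff_0 [simp]: "theta_coeff s k 0 = 1"
  by (simp add: theta_coeff_def)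

lemma minus_one_powi_shift: "(-1 :: complex) powi (r + 1) = - ((-1) powi r)"
  "(-1 :: complex) powi (r - 1) = - ((-1) powi r)"
  by (simp_all add: power_int_add power_int_diff)

text \<open>
  The hypothesis of the finite triple product for \<open>q = s^(4k+3)\<close> and \<open>z = s\<close>.
\<close>
lemma theta_coeff_triple_product:
  assumes "s \<noteq> 0"
  shows "theta_coeff s k (r - 1) * (s ^ (3 + 4 * k)) powi r = - s * theta_coeff s k r"
proof -
  have e: "(2 * int k * ((r - 1) * (r - 1 + 1)) + (r - 1) * (3 * (r - 1) + 1) div 2) + int (3 + 4 * k) * r
      = 1 + (2 * int k * (r * (r + 1)) + r * (3 * r + 1) div 2)"
    using two_mult_pentagonal[of r] two_mult_pentagonal[of "r - 1"] by (simp add: algebra_simps)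
  have "theta_coeff s k (r - 1) * (s ^ (3 + 4 * k)) powi r = - ((-1) powi r) *
     s powi ((2 * int k * ((r - 1) * (r - 1 + 1)) + (r - 1) * (3 * (r - 1) + 1) div 2) + int (3 + 4 * k) * r)"
    using assms by (subst power_int_add) (simp_all add: theta_coeff_def minus_one_powi_shift power_int_power)
  also have "\<dots> = - s * theta_coeff s k r"
    unfolding e using assms by (subst power_int_add) (simp_all add: theta_coeff_def)
  finally show ?thesis .
qed

text \<open>
  For base \<open>s\<^sup>2\<close> and \<open>k = 0\<close> the shifted sequence in \<open>odd_sum_step\<close> is a multiple of the reflected original one,
  and the weight of \<open>even_sum\<close> does not see the reflection \<open>r \<leftrightarrow> -r\<close>.
\<close>
lemma theta_coeff_reflect_even:
  assumes "s \<noteq> 0"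
  shows "(s\<^sup>2) powi (int n + r) * theta_coeff s 0 (r - 1) = - (s ^ (2 * n + 1)) * theta_coeff s 0 (- r)"
proof -
  have e: "2 * (int n + r) + (r - 1) * (3 * (r - 1) + 1) div 2
      = int (2 * n + 1) + (- r) * (3 * (- r) + 1) div 2"
    using two_mult_pentagonal[of "- r"] two_mult_pentagonal[of "r - 1"] by (simp add: algebra_simps)
  have "(s\<^sup>2) powi (int n + r) * theta_coeff s 0 (r - 1)
     = - ((-1) powi r) * s powi (2 * (int n + r) + (r - 1) * (3 * (r - 1) + 1) div 2)"
    using assms by (subst power_int_add) (simp_all add: theta_coeff_def minus_one_powi_shift power_int_power)
  also have "\<dots> = - (s ^ (2 * n + 1)) * theta_coeff s 0 (- r)"
    unfolding e using assms
    by (subst power_int_add) (simp_all add: theta_coeff_def power_int_minus_one_minus del: of_nat_Suc of_nat_add of_nat_mult)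
  finally show ?thesis .
qed

text \<open>
  The shifted sequence in \<open>even_sum_step\<close> is antisymmetric under \<open>r \<leftrightarrow> -1-r\<close>, hence orthogonal to the
  weight of \<open>odd_sum\<close>.
\<close>
lemma theta_coeff_antisymmetric:
  assumes "s \<noteq> 0"
  shows "(s\<^sup>2) powi (int n - (- 1 - r)) * theta_coeff s 0 ((- 1 - r) + 1)
       = - ((s\<^sup>2) powi (int n - r) * theta_coeff s 0 (r + 1))"
proof -
  have e: "2 * (int n - (- 1 - r)) + (- r) * (3 * (- r) + 1) div 2
      = 2 * (int n - r) + (r + 1) * (3 * (r + 1) + 1) div 2"
    using two_mult_pentagonal[of "- r"] two_mult_pentagonal[of "r + 1"] by (simp add: algebra_simps)
  have "(s\<^sup>2) powi (int n - (- 1 - r)) * theta_coeff s 0 ((- 1 - r) + 1)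
      = (-1) powi r * s powi (2 * (int n - (- 1 - r)) + (- r) * (3 * (- r) + 1) div 2)"
    using assms by (subst power_int_add) (simp_all add: theta_coeff_def power_int_minus_one_minus power_int_power)
  also have "\<dots> = - ((s\<^sup>2) powi (int n - r) * theta_coeff s 0 (r + 1))"
    unfolding e using assms
    by (subst power_int_add) (simp_all add: theta_coeff_def minus_one_powi_shift power_int_power)
  finally show ?thesis .
qed

text \<open>
  Passing from row \<open>2n\<close> to row \<open>2n+1\<close> contributes the factor \<open>1 - s q^n\<close>, by \<open>theta_coeff_reflect_even\<close>;
  passing on to row \<open>2n+2\<close> contributes nothing, by \<open>theta_coeff_antisymmetric\<close>.
\<close>
lemma odd_sum_theta:
  assumes s: "norm s < 1" "s \<noteq> 0"
  shows "odd_sum (s\<^sup>2) (theta_coeff s 0) n = qpoch s (s\<^sup>2) (Suc n) / qpoch (s\<^sup>2) (s\<^sup>2) (2 * n + 1)"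
proof -
  define q where "q = s\<^sup>2"
  have q: "norm q < 1" "q \<noteq> 0" using s by (auto simp: q_def norm_power power_less_one_iff)
  have nz: "1 - q ^ Suc m \<noteq> 0" for m using one_minus_power_nonzero[OF q(1)] by blast
  have "(1 - q ^ (2 * n + 1)) * odd_sum q (theta_coeff s 0) n
      = (1 - s * q ^ n) * even_sum q (theta_coeff s 0) n" for n
  proof -
    have "even_sum q (\<lambda>r. q powi (int n + r) * theta_coeff s 0 (r - 1)) n
        = even_sum q (\<lambda>r. - (s ^ (2 * n + 1)) * theta_coeff s 0 (- r)) n"
      unfolding q_def using theta_coeff_reflect_even[OF s(2)] by simp
    also have "\<dots> = - (s ^ (2 * n + 1)) * even_sum q (theta_coeff s 0) n"
      by (simp only: even_sum_scale even_sum_reflect)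
    finally show ?thesis unfolding odd_sum_step[OF q] even_sum_add
      by (simp add: q_def power_mult[symmetric] algebra_simps)
  qed
  then have odd: "odd_sum q (theta_coeff s 0) n
      = (1 - s * q ^ n) * even_sum q (theta_coeff s 0) n / (1 - q ^ Suc (2 * n))" for n
    using nz[of "2 * n"] by (simp add: eq_divide_eq mult.commute)
  have "(1 - q ^ (2 * n + 2)) * even_sum q (theta_coeff s 0) (Suc n) = odd_sum q (theta_coeff s 0) n" for n
  proof -
    let ?b = "\<lambda>r. q powi (int n - r) * theta_coeff s 0 (r + 1)"
    have "odd_sum q ?b n = odd_sum q (\<lambda>r. ?b (- 1 - r)) n"
      by (rule odd_sum_reflect[symmetric])
    also have "\<dots> = odd_sum q (\<lambda>r. - 1 * ?b r) n"
      unfolding q_def theta_coeff_antisymmetric[OF s(2)] by simp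
    also have "\<dots> = - odd_sum q ?b n"
      unfolding odd_sum_scale by simp
    finally have "odd_sum q ?b n = 0" by simp
    then show ?thesis unfolding even_sum_step[OF q] odd_sum_add by simp
  qed
  then have even: "even_sum q (theta_coeff s 0) (Suc n)
      = odd_sum q (theta_coeff s 0) n / (1 - q ^ Suc (2 * n + 1))" for n
    using nz[of "2 * n + 1"] by (simp add: eq_divide_eq mult.commute)
  have *: "even_sum q (theta_coeff s 0) n = qpoch s q n / qpoch q q (2 * n)" for n
  proof (induction n)
    case 0
    then show ?case by (simp add: even_sum_def recip_qpoch_def)
  next
    case (Suc n)
    have e: "2 * Suc n = Suc (Suc (2 * n))" by simp
    show ?case unfolding even odd Suc e qpoch_Suc[of s] qpoch_self_Suc by simp
  qed
  show ?thesis unfolding q_def[symmetric] odd * by (simp add: qpoch_Suc)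
qed

section \<open>The multiple sum as an iterated Bailey step\<close>

lemma summable_on_PiE_geometric:
  fixes x :: real
  assumes x: "0 \<le> x" "x < 1" and "finite I"
  shows "(\<lambda>n. \<Prod>i\<in>I. x ^ n i) summable_on (I \<rightarrow>\<^sub>E (UNIV :: nat set))"
proof -
  have "Infinite_Set_Sum.abs_summable_on (\<lambda>n. \<Prod>i\<in>I. x ^ n i) (I \<rightarrow>\<^sub>E (UNIV :: nat set))"
    using assms by (intro abs_summable_on_prod_PiE) (auto simp: abs_summable_on_nat_iff' summable_geometric)
  then show ?thesis
    unfolding abs_summable_equivalent[symmetric] by (rule abs_summable_summable)
qed

text \<open>
  The summand of the theorem, with an arbitrary sequence \<open>\<beta>\<close> at the innermost index.
\<close>
definition multi_term :: "complex \<Rightarrow> nat \<Rightarrow> (nat \<Rightarrow> complex) \<Rightarrow> (nat \<Rightarrow> nat) \<Rightarrow> complex" where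
  "multi_term q k \<beta> n = q ^ (\<Sum>j=1..k. (tail_sum k n j)\<^sup>2 + tail_sum k n j) * \<beta> (n k) /
     (\<Prod>i=1..<k. qpoch q q (n i))"

text \<open>
  Since \<open>N\<^sub>j \<ge> n\<^sub>j\<close>, the exponent of \<open>q\<close> is at least \<open>n\<^sub>1 + \<dots> + n\<^sub>k\<close>, so a product of geometric series
  is a majorant.
\<close>
lemma multi_term_summable:
  assumes q: "norm q < 1" and \<beta>: "\<And>n. norm (\<beta> n) \<le> C"
  shows "multi_term q k \<beta> summable_on ({1..k} \<rightarrow>\<^sub>E (UNIV :: nat set))"
proof -
  obtain D where D: "\<And>n. norm (1 / qpoch q q n) \<le> D"
    using inverse_qpoch_bounded[OF q] by blast
  have majorant: "(\<lambda>n. (\<Prod>i\<in>{1..k}. norm q ^ n i) * (C * D ^ card {1..<k})) summable_on ({1..k} \<rightarrow>\<^sub>E (UNIV :: nat set))"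
    using q by (intro summable_on_cmult_left summable_on_PiE_geometric) auto
  have bound: "norm (multi_term q k \<beta> n) \<le> (\<Prod>i\<in>{1..k}. norm q ^ n i) * (C * D ^ card {1..<k})" for n
  proof -
    have exponent: "norm q ^ (\<Sum>j=1..k. (tail_sum k n j)\<^sup>2 + tail_sum k n j) \<le> norm q ^ (\<Sum>j=1..k. n j)"
    proof (intro power_decreasing sum_mono)
      fix j assume "j \<in> {1..k}"
      then have "n j \<le> tail_sum k n j"
        unfolding tail_sum_def by (intro member_le_sum) auto
      then show "n j \<le> (tail_sum k n j)\<^sup>2 + tail_sum k n j" by simp
    qed (use q in auto)
    have denominator: "norm (1 / (\<Prod>i=1..<k. qpoch q q (n i))) \<le> D ^ card {1..<k}"
    proof -
      have "norm (1 / (\<Prod>i=1..<k. qpoch q q (n i))) = (\<Prod>i=1..<k. norm (1 / qpoch q q (n i)))"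
        by (simp add: norm_divide prod_norm prod_dividef)
      also have "\<dots> \<le> (\<Prod>i=1..<k. D)" by (intro prod_mono) (use D in auto)
      finally show ?thesis by simp
    qed
    have "0 \<le> C" using order_trans[OF norm_ge_zero \<beta>[of "n k"]] .
    then have "norm (\<beta> (n k)) * norm (1 / (\<Prod>i=1..<k. qpoch q q (n i))) \<le> C * D ^ card {1..<k}"
      by (intro mult_mono \<beta> denominator norm_ge_zero)
    then have "norm q ^ (\<Sum>j=1..k. (tail_sum k n j)\<^sup>2 + tail_sum k n j) *
        (norm (\<beta> (n k)) * norm (1 / (\<Prod>i=1..<k. qpoch q q (n i)))) \<le>
        norm q ^ (\<Sum>j=1..k. n j) * (C * D ^ card {1..<k})"
      by (rule mult_mono[OF exponent _ zero_le_power[OF norm_ge_zero] mult_nonneg_nonneg[OF norm_ge_zero norm_ge_zero]])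
    moreover have "norm (multi_term q k \<beta> n) =
        norm q ^ (\<Sum>j=1..k. (tail_sum k n j)\<^sup>2 + tail_sum k n j) *
        (norm (\<beta> (n k)) * norm (1 / (\<Prod>i=1..<k. qpoch q q (n i))))"
      by (simp only: multi_term_def norm_mult norm_divide norm_power norm_one times_divide_eq_right mult_1_right mult.assoc)
    ultimately show ?thesis by (simp only: power_sum)
  qed
  show ?thesis
    by (rule abs_summable_summable, rule Infinite_Sum.abs_summable_on_comparison_test'[OF majorant bound])
qed

text \<open>
  Replacing the last two indices \<open>n\<^sub>K\<close>, \<open>n\<^sub>K\<^sub>+\<^sub>1\<close> by their sum \<open>\<mu> K = n\<^sub>K + n\<^sub>K\<^sub>+\<^sub>1\<close> and by \<open>j = n\<^sub>K\<^sub>+\<^sub>1\<close> leaves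
  \<open>N\<^sub>1, \<dots>, N\<^sub>K\<close> unchanged. What is left over is one summand of \<open>bailey_step\<close>.
\<close>
lemma multi_term_split_last:
  assumes K: "1 \<le> K" and j: "j \<le> \<mu> K"
  shows "multi_term q (Suc K) \<beta> (\<mu>(K := \<mu> K - j, Suc K := j)) =
    multi_term q K (\<lambda>_. q ^ (j\<^sup>2 + j) * \<beta> j / qpoch q q (\<mu> K - j)) \<mu>"
proof -
  let ?n = "\<mu>(K := \<mu> K - j, Suc K := j)"
  have tail: "tail_sum (Suc K) ?n i = tail_sum K \<mu> i" if "i \<in> {1..K}" for i
  proof -
    have "{i..Suc K} = insert (Suc K) (insert K {i..<K})" "{i..K} = insert K {i..<K}" using that by auto
    then show ?thesis using j by (simp add: tail_sum_def)
  qed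
  have "(\<Sum>i=1..Suc K. (tail_sum (Suc K) ?n i)\<^sup>2 + tail_sum (Suc K) ?n i)
      = (\<Sum>i=1..K. (tail_sum K \<mu> i)\<^sup>2 + tail_sum K \<mu> i) + (j\<^sup>2 + j)"
    using K tail by (simp add: sum.nat_ivl_Suc' tail_sum_def[of "Suc K" _ "Suc K"])
  moreover have "(\<Prod>i=1..<Suc K. qpoch q q (?n i)) = (\<Prod>i=1..<K. qpoch q q (\<mu> i)) * qpoch q q (\<mu> K - j)"
    using K by (simp add: prod.atLeastLessThan_Suc)
  ultimately show ?thesis
    unfolding multi_term_def by (simp only: power_add fun_upd_same) (simp add: mult_ac)
qed

text \<open>
  Summing over the innermost index, with the sum of the last two indices held fixed, is one Bailey step; this
  is a finite sum, so absolute summability of the whole family justifies the induction on the number of indices.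
\<close>
lemma has_sum_multi_term:
  assumes q: "norm q < 1" and "\<And>n. norm (\<beta> n) \<le> C"
  shows "(multi_term q (Suc m) \<beta> has_sum (\<Sum>n. q ^ (n\<^sup>2 + n) * (bailey_step q ^^ m) \<beta> n))
           ({1..Suc m} \<rightarrow>\<^sub>E (UNIV :: nat set))"
  using assms(2)
proof (induction m arbitrary: \<beta> C)
  case 0
  have "summable (\<lambda>n. norm (q ^ (n\<^sup>2 + n) * \<beta> n))"
    by (rule summable_power_square_mult_bounded[OF q 0])
  then have "((\<lambda>n. q ^ (n\<^sup>2 + n) * \<beta> n) has_sum (\<Sum>n. q ^ (n\<^sup>2 + n) * \<beta> n)) UNIV"
    by (intro norm_summable_imp_has_sum summable_sums) (auto dest: summable_norm_cancel)
  then show ?case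
    by (subst has_sum_reindex_bij_witness[where T = UNIV and j = "\<lambda>n. n 1" and i = "\<lambda>x. \<lambda>i\<in>{1}. x"
          and h = "\<lambda>n. q ^ (n\<^sup>2 + n) * \<beta> n"])
       (auto simp: multi_term_def tail_sum_def fun_eq_iff PiE_def extensional_def)
next
  case (Suc m)
  let ?K = "Suc m" and ?f = "\<lambda>(\<mu>, j). multi_term q (Suc (Suc m)) \<beta> (\<mu>(Suc m := \<mu> (Suc m) - j, Suc (Suc m) := j))"
  let ?A = "\<lambda>k. {1..k} \<rightarrow>\<^sub>E (UNIV :: nat set)"
  let ?S = "SIGMA \<mu>:?A ?K. {..\<mu> ?K}"
  \<comment> \<open>The bijection behind \<open>multi_term_split_last\<close>; the restriction keeps the image extensional.\<close>
  let ?split = "\<lambda>n. (\<lambda>i\<in>{1..?K}. if i = ?K then n ?K + n (Suc ?K) else n i, n (Suc ?K))"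
  let ?merge = "\<lambda>(\<mu>, j). \<mu>(?K := \<mu> ?K - j, Suc ?K := j)"
  obtain C' where C': "\<And>n. norm (bailey_step q \<beta> n) \<le> C'"
    using bounded_of_tendsto[OF bailey_step_limit[OF q, of \<beta> C, OF Suc.prems]] by blast
  have reindex: "(multi_term q (Suc ?K) \<beta> has_sum x) (?A (Suc ?K)) \<longleftrightarrow> (?f has_sum x) ?S" for x
  proof (rule has_sum_reindex_bij_witness[where j = ?split and i = ?merge])
    fix n assume n: "n \<in> ?A (Suc ?K)"
    show *: "?merge (?split n) = n"
      using n by (intro ext) (auto simp: PiE_iff extensional_def)
    show "?split n \<in> ?S" by auto
    show "?f (?split n) = multi_term q (Suc ?K) \<beta> n"
      using arg_cong[OF *, of "multi_term q (Suc ?K) \<beta>"] by simp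
  next
    fix p assume "p \<in> ?S"
    then obtain \<mu> j where p: "p = (\<mu>, j)" "\<mu> \<in> ?A ?K" "j \<le> \<mu> ?K" by blast
    then have "(\<lambda>i\<in>{1..?K}. if i = ?K then \<mu> ?K - j + j else \<mu> i) = \<mu>"
      by (intro ext) (auto simp: PiE_iff extensional_def)
    then show "?split (?merge p) = p" by (simp add: p(1) cong: if_cong restrict_cong)
    show "?merge p \<in> ?A (Suc ?K)"
      using p(2) by (auto simp: p(1) PiE_iff extensional_def)
  qed simp
  have inner: "((\<lambda>j. ?f (\<mu>, j)) has_sum multi_term q ?K (bailey_step q \<beta>) \<mu>) {..\<mu> ?K}" for \<mu>
  proof (rule has_sum_finiteI)
    have "(\<Sum>j\<le>\<mu> ?K. ?f (\<mu>, j)) =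
        (\<Sum>j\<le>\<mu> ?K. multi_term q ?K (\<lambda>_. q ^ (j\<^sup>2 + j) * \<beta> j / qpoch q q (\<mu> ?K - j)) \<mu>)"
      by (intro sum.cong refl) (simp only: prod.case, rule multi_term_split_last, auto)
    also have "\<dots> = multi_term q ?K (bailey_step q \<beta>) \<mu>"
      by (simp only: multi_term_def bailey_step_def sum_distrib_left sum_divide_distrib)
    finally show "multi_term q ?K (bailey_step q \<beta>) \<mu> = (\<Sum>j\<le>\<mu> ?K. ?f (\<mu>, j))" by simp
  qed simp
  have "?f summable_on ?S"
    using multi_term_summable[OF q, of \<beta> C "Suc ?K", OF Suc.prems] reindex unfolding summable_on_def by blast
  with Suc.IH[OF C'] have "(?f has_sum (\<Sum>n. q ^ (n\<^sup>2 + n) * (bailey_step q ^^ m) (bailey_step q \<beta>) n)) ?S"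
    by (intro has_sum_SigmaI[OF inner])
  then show ?case unfolding reindex by (simp only: funpow_Suc_right o_apply)
qed

section \<open>The seed pair and its theta series\<close>

lemma qpoch_0_0 [simp]: "qpoch 0 0 n = 1"
  by (simp add: qpoch_def)

text \<open>
  Pair \<open>1 - s q^m\<close> with \<open>1 + s q^m\<close> to get the factors \<open>1 - q^(2m+1)\<close>, where \<open>q = s\<^sup>2\<close>; the third product
  supplies the factors \<open>1 - q^(2m+2)\<close>.
\<close>
lemma qpoch_double_split:
  "qpoch s (s\<^sup>2) (Suc n) * qpoch (- s) (s\<^sup>2) (Suc n) * qpoch ((s\<^sup>2)\<^sup>2) ((s\<^sup>2)\<^sup>2) n
     = qpoch (s\<^sup>2) (s\<^sup>2) (2 * n + 1)"
proof (induction n)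
  case 0
  then show ?case by (simp add: qpoch_Suc power2_eq_square algebra_simps)
next
  case (Suc n)
  define q where "q = s\<^sup>2"
  have "(1 - s * q ^ Suc n) * (1 + s * q ^ Suc n) = 1 - q * q ^ (2 * n + 2)"
    unfolding q_def by (simp add: algebra_simps power2_eq_square power_add power_mult power_mult_distrib)
  moreover have "1 - q\<^sup>2 * (q\<^sup>2) ^ n = 1 - q * q ^ (2 * n + 1)"
    by (simp add: power2_eq_square power_add power_mult power_mult_distrib)
  ultimately have "qpoch s q (Suc (Suc n)) * qpoch (- s) q (Suc (Suc n)) * qpoch (q\<^sup>2) (q\<^sup>2) (Suc n)
     = (qpoch s q (Suc n) * qpoch (- s) q (Suc n) * qpoch (q\<^sup>2) (q\<^sup>2) n) *
       (1 - q * q ^ (2 * n + 1)) * (1 - q * q ^ (2 * n + 2))"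
    unfolding qpoch_Suc[of _ _ "Suc n"] qpoch_Suc[of "q\<^sup>2"] by (simp only: mult_minus_left diff_minus_eq_add mult_ac)
  also have "\<dots> = qpoch q q (2 * Suc n + 1)"
    using Suc.IH unfolding q_def[symmetric] by (simp add: qpoch_Suc)
  finally show ?case unfolding q_def .
qed

lemma theta_coeff_base_0: "theta_coeff 0 0 r = (if r = 0 then 1 else 0)"
proof -
  have "r = 0" if "r * (3 * r + 1) div 2 = 0"
  proof -
    have "r * (3 * r + 1) = 0" using two_mult_pentagonal[of r] that by simp
    then show ?thesis unfolding mult_eq_0_iff by presburger
  qed
  then show ?thesis by (auto simp: theta_coeff_def)
qed

definition seed_alpha :: "complex \<Rightarrow> nat \<Rightarrow> complex" where
  "seed_alpha s r = theta_coeff s 0 (int r) + theta_coeff s 0 (- 1 - int r)"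

definition seed_beta :: "complex \<Rightarrow> nat \<Rightarrow> complex" where
  "seed_beta s n = 1 / (qpoch (- s) (s\<^sup>2) (n + 1) * qpoch ((s\<^sup>2)\<^sup>2) ((s\<^sup>2)\<^sup>2) n)"

lemma seed_alpha_base_0: "seed_alpha 0 r = (if r = 0 then 1 else 0)"
  by (simp add: seed_alpha_def theta_coeff_base_0)

text \<open>
  For \<open>s \<noteq> 0\<close> this is \<open>odd_sum_theta\<close> after folding. For \<open>s = 0\<close>, where the laws of integer exponents
  break down, only \<open>r = 0\<close> contributes.
\<close>
lemma seed_bailey_pair:
  assumes s: "norm s < 1"
  shows "bailey_pair (s\<^sup>2) (seed_alpha s) (seed_beta s)"
proof (cases "s = 0")
  case True
  have "(\<Sum>r\<le>n. seed_alpha s r / (qpoch (s\<^sup>2) (s\<^sup>2) (n - r) * qpoch (s\<^sup>2) (s\<^sup>2) (n + r + 1)))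
      = (\<Sum>r\<le>n. if r = 0 then 1 else 0)" for n
    by (simp add: True seed_alpha_base_0)
  then show ?thesis
    unfolding bailey_pair_def by (simp add: seed_beta_def True)
next
  case False
  have q: "norm (s\<^sup>2) < 1" using s by (simp add: norm_power power_less_one_iff)
  have "odd_sum (s\<^sup>2) (theta_coeff s 0) n = seed_beta s n" for n
    using qpoch_nonzero[OF s q, of "Suc n"]
    unfolding odd_sum_theta[OF s False] qpoch_double_split[symmetric] seed_beta_def by simp
  then have "odd_sum (s\<^sup>2) (theta_coeff s 0) = seed_beta s" by blast
  then show ?thesis
    using bailey_pair_odd_sum[of "s\<^sup>2" "theta_coeff s 0"] by (simp add: seed_alpha_def[abs_def])
qed

lemma norm_theta_coeff_le:
  assumes s: "norm s < 1" and m: "2 * int m \<le> r * (3 * r + 1)"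
  shows "norm (theta_coeff s 0 r) \<le> norm s ^ m"
proof -
  obtain e where e: "r * (3 * r + 1) div 2 = int e" "m \<le> e"
    using m two_mult_pentagonal[of r] that[of "nat (r * (3 * r + 1) div 2)"] by simp
  then have "norm (theta_coeff s 0 r) = norm s ^ e"
    by (simp add: theta_coeff_def norm_mult norm_power norm_power_int)
  then show ?thesis using e s by (simp add: power_decreasing)
qed

lemma summable_seed_alpha:
  assumes s: "norm s < 1"
  shows "summable (\<lambda>r. norm ((s\<^sup>2) ^ (k * (r\<^sup>2 + r)) * seed_alpha s r))"
proof (rule summable_comparison_test')
  show "summable (\<lambda>r. 2 * norm s ^ r)" using s by (intro summable_mult summable_geometric) simp
  fix r :: nat
  have "int r \<le> int r * int r" by (simp flip: of_nat_mult)
  then have "norm (theta_coeff s 0 (int r)) \<le> norm s ^ r"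
    by (intro norm_theta_coeff_le s) (simp add: algebra_simps)
  moreover have "norm (theta_coeff s 0 (- 1 - int r)) \<le> norm s ^ r"
    using zero_le_square[of "int r"] by (intro norm_theta_coeff_le s) (simp add: algebra_simps)
  ultimately have "norm (seed_alpha s r) \<le> 2 * norm s ^ r"
    unfolding seed_alpha_def by (intro norm_triangle_le) simp
  moreover have "norm ((s\<^sup>2) ^ (k * (r\<^sup>2 + r))) \<le> 1"
    using s by (simp add: norm_power power_le_one)
  ultimately show "norm (norm ((s\<^sup>2) ^ (k * (r\<^sup>2 + r)) * seed_alpha s r)) \<le> 2 * norm s ^ r"
    using mult_mono[of "norm ((s\<^sup>2) ^ (k * (r\<^sup>2 + r)))" 1 "norm (seed_alpha s r)" "2 * norm s ^ r"]
    by (simp add: norm_mult)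
qed

text \<open>
  The quantity \<open>r\<^sup>2 + r = r (r + 1)\<close> is invariant under \<open>r \<leftrightarrow> -1-r\<close>, so the factor produced by the Bailey chain can
  be pulled inside the folding.
\<close>
lemma power_mult_seed_alpha:
  assumes "s \<noteq> 0"
  shows "(s\<^sup>2) ^ (k * (r\<^sup>2 + r)) * seed_alpha s r = theta_coeff s k (int r) + theta_coeff s k (- 1 - int r)"
proof -
  have shift: "(s\<^sup>2) ^ (k * (r\<^sup>2 + r)) * theta_coeff s 0 x = theta_coeff s k x"
    if x: "x * (x + 1) = int (r\<^sup>2 + r)" for x
  proof -
    have "2 * int k * (x * (x + 1)) = int (2 * (k * (r\<^sup>2 + r)))"
      unfolding x by (simp add: mult.assoc)
    then have "(s\<^sup>2) ^ (k * (r\<^sup>2 + r)) = s powi (2 * int k * (x * (x + 1)))"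
      by (simp only: power_int_of_nat power_mult)
    then show ?thesis using assms unfolding theta_coeff_def by (simp add: power_int_add)
  qed
  have f: "int r * (int r + 1) = int (r\<^sup>2 + r)" "(- 1 - int r) * (- 1 - int r + 1) = int (r\<^sup>2 + r)"
    by (simp_all add: power2_eq_square algebra_simps)
  show ?thesis unfolding seed_alpha_def
    by (simp only: distrib_left[of "(s\<^sup>2) ^ (k * (r\<^sup>2 + r))"] shift[OF f(1)] shift[OF f(2)])
qed

text \<open>
  The infinite triple product: by folding, the finite triple product with base \<open>Q = s^(4k+3)\<close> is itself a Bailey
  pair relative to \<open>Q\<close>, so \<open>bailey_pair_limit\<close> gives its limit as a theta series, to be compared with the
  limit of the product side.
\<close>
lemma suminf_seed_alpha:
  assumes s: "norm s < 1"
  shows "(\<Sum>r. (s\<^sup>2) ^ (k * (r\<^sup>2 + r)) * seed_alpha s r)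
       = qpoch_inf_list [s, (s\<^sup>2) ^ (1 + 2 * k), s ^ (3 + 4 * k)] (s ^ (3 + 4 * k))"
proof (cases "s = 0")
  case True
  have "(\<Sum>r. (s\<^sup>2) ^ (k * (r\<^sup>2 + r)) * seed_alpha s r) = (\<Sum>r\<in>{0}. (s\<^sup>2) ^ (k * (r\<^sup>2 + r)) * seed_alpha s r)"
    by (rule suminf_finite) (auto simp: True seed_alpha_base_0)
  then show ?thesis
    by (simp add: True seed_alpha_base_0 qpoch_inf_list_def qpoch_inf_def zero_power)
next
  case False
  define Q where "Q = s ^ (3 + 4 * k)"
  define w where "w = (s\<^sup>2) ^ (1 + 2 * k)"
  define S where "S = (\<Sum>r. (s\<^sup>2) ^ (k * (r\<^sup>2 + r)) * seed_alpha s r)"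
  have Q: "norm Q < 1" "Q \<noteq> 0"
    using s False by (auto simp: Q_def norm_power power_less_one_iff)
  have "bailey_pair Q (\<lambda>r. (s\<^sup>2) ^ (k * (r\<^sup>2 + r)) * seed_alpha s r) (odd_sum Q (theta_coeff s k))"
    unfolding power_mult_seed_alpha[OF False] by (rule bailey_pair_odd_sum)
  from bailey_pair_limit[OF Q(1) this summable_seed_alpha[OF s]]
  have "odd_sum Q (theta_coeff s k) \<longlonglongrightarrow> S / (qpoch_inf Q Q)\<^sup>2"
    unfolding S_def .
  moreover have "odd_sum Q (theta_coeff s k) = (\<lambda>n. qpoch s Q (Suc n) * qpoch w Q n / qpoch Q Q (2 * n + 1))"
  proof (intro ext finite_jacobi_triple_product(2)[OF Q])
    show "s * w = Q" unfolding w_def Q_def power_mult[symmetric] power_Suc[symmetric]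
      by (rule arg_cong[of _ _ "power s"]) simp
    show "theta_coeff s k (r - 1) * Q powi r = - s * theta_coeff s k r" for r
      unfolding Q_def by (rule theta_coeff_triple_product[OF False])
  qed simp
  moreover have "(\<lambda>n. qpoch s Q (Suc n) * qpoch w Q n / qpoch Q Q (2 * n + 1))
      \<longlonglongrightarrow> qpoch_inf s Q * qpoch_inf w Q / qpoch_inf Q Q"
  proof (intro tendsto_intros qpoch_inf_nonzero Q qpoch_tendsto)
    show "(\<lambda>n. qpoch s Q (Suc n)) \<longlonglongrightarrow> qpoch_inf s Q"
      by (rule LIMSEQ_Suc[OF qpoch_tendsto[OF Q(1)]])
    have "strict_mono (\<lambda>n::nat. 2 * n + 1)" by (auto simp: strict_mono_def)
    from LIMSEQ_subseq_LIMSEQ[OF qpoch_tendsto[OF Q(1)] this]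
    show "(\<lambda>n. qpoch Q Q (2 * n + 1)) \<longlonglongrightarrow> qpoch_inf Q Q" by (simp add: o_def)
  qed
  ultimately have "S / (qpoch_inf Q Q)\<^sup>2 = qpoch_inf s Q * qpoch_inf w Q / qpoch_inf Q Q"
    by (simp add: LIMSEQ_unique)
  then have "S = qpoch_inf s Q * qpoch_inf w Q * qpoch_inf Q Q"
    using qpoch_inf_nonzero[OF Q(1) Q(1)] by (simp add: field_simps power2_eq_square)
  then show ?thesis unfolding S_def w_def[symmetric] Q_def[symmetric]
    by (simp add: qpoch_inf_list_def mult.assoc)
qed

section \<open>The identity\<close>

theorem theorem1p2:
  fixes q s :: complex and k :: nat
  assumes "norm q < 1" and "s ^ 2 = q" and "k \<ge> 1"
  shows "((\<lambda>n. q ^ (\<Sum>j=1..k. (tail_sum k n j) ^ 2 + tail_sum k n j) /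
            ((\<Prod>i=1..<k. qpoch q q (n i)) * qpoch (- s) q (n k + 1) * qpoch (q ^ 2) (q ^ 2) (n k)))
          has_sum
          (qpoch_inf_list [s, q ^ (1 + 2 * k), s ^ (3 + 4 * k)] (s ^ (3 + 4 * k)) / qpoch_inf q q))
         ({1..k} \<rightarrow>\<^sub>E (UNIV :: nat set))"
proof -
  have q: "norm q < 1" by fact
  have qs: "q = s\<^sup>2" using assms(2) by (rule sym)
  have s: "norm s < 1" using q by (simp add: qs norm_power power_less_one_iff)
  obtain m where k: "k = Suc m" using assms(3) by (cases k) auto
  define T where "T = (\<Sum>n. q ^ (n\<^sup>2 + n) * (bailey_step q ^^ m) (seed_beta s) n)"
  define \<Theta> where "\<Theta> = qpoch_inf_list [s, q ^ (1 + 2 * k), s ^ (3 + 4 * k)] (s ^ (3 + 4 * k))"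
  have pair: "bailey_pair q (seed_alpha s) (seed_beta s)"
    unfolding qs by (rule seed_bailey_pair[OF s])
  have "summable (\<lambda>r. norm (seed_alpha s r))"
    using summable_seed_alpha[OF s, of 0] by simp
  from bounded_of_tendsto[OF bailey_pair_limit[OF q pair this]]
  obtain C where C: "\<And>n. norm (seed_beta s n) \<le> C" by blast
  obtain C' where C': "\<And>n. norm ((bailey_step q ^^ m) (seed_beta s) n) \<le> C'"
    using bailey_step_iterated_bounded[OF q, of "seed_beta s" C m] C by blast
  \<comment> \<open>Two evaluations of the limit of the \<open>k\<close>-th \<open>\<beta>\<close>: from its definition as a Bailey step, and from its \<open>\<alpha>\<close>.\<close>
  have "(bailey_step q ^^ k) (seed_beta s) \<longlonglongrightarrow> T / qpoch_inf q q"
    using bailey_step_limit[OF q C'] unfolding T_def k by simp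
  moreover have "(bailey_step q ^^ k) (seed_beta s) \<longlonglongrightarrow> \<Theta> / (qpoch_inf q q)\<^sup>2"
    using bailey_pair_limit[OF q bailey_lemma_iterated[OF q pair, of k]] summable_seed_alpha[OF s, of k]
    unfolding \<Theta>_def qs suminf_seed_alpha[OF s] by blast
  ultimately have "T / qpoch_inf q q = \<Theta> / (qpoch_inf q q)\<^sup>2"
    by (rule LIMSEQ_unique)
  then have T: "T = \<Theta> / qpoch_inf q q"
    using qpoch_inf_nonzero[OF q q] by (simp add: field_simps power2_eq_square)
  have "(multi_term q k (seed_beta s) has_sum T) ({1..k} \<rightarrow>\<^sub>E UNIV)"
    unfolding T_def k by (rule has_sum_multi_term[OF q C])
  moreover have "multi_term q k (seed_beta s) =
      (\<lambda>n. q ^ (\<Sum>j=1..k. (tail_sum k n j) ^ 2 + tail_sum k n j) /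
            ((\<Prod>i=1..<k. qpoch q q (n i)) * qpoch (- s) q (n k + 1) * qpoch (q ^ 2) (q ^ 2) (n k)))"
    by (simp add: fun_eq_iff multi_term_def seed_beta_def mult_ac flip: qs)
  ultimately show ?thesis unfolding T \<Theta>_def by simp
qed

end
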